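(* For every connected undirected graph $G$ on exactly $4$ vertices, $\mathbf{C}_G=\frac34$; that is, $\mathrm{Var}\, M_G f\le \frac34 \mathrm{Var} f$ for all $f\colon V\to\mathbb{R}$, and the constant $\frac34$ cannot be replaced by any smaller number. (Concretely, this holds for each of the six such graphs up to isomorphism: the complete graph $K_4$, the star $S_4$ (one central vertex adjacent to three leaves), the cycle $C_4$, the path $P_4$, the paw graph (a triangle with one pendant vertex attached to one triangle vertex), and the diamond graph ($K_4$ minus one edge).)
   Context: Let $G=(V,E)$ be a finite connected undirected graph, with graph distance $d_G(v,w)$ equal to the number of edges in a shortest path from $v$ to $w$. The ball is $\mathrm{B}_G(v,r)=\{w\in V: d_G(v,w)\le r\}$. The Hardy–Littlewood maximal operator on $G$ is $(M_G f)(v)=\max_{r\ge 0}\frac{1}{|\mathrm{B}_G(v,r)|}\sum_{w\in \mathrm{B}_G(v,r)}|f(w)|$. The variation is $\mathrm{Var} f=\sum_{vw\in E}|f(v)-f(w)|$ (each edge counted once). $\mathbf{C}_G$ is the smallest number in $[0,\infty]$ such that $\mathrm{Var}\, M_G f\le \mathbf{C}_G \mathrm{Var} f$ for all $f\colon V\to\mathbb{R}$. *)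

theory Defs
  imports Complex_Main "HOL-Library.Extended_Real"
begin

definition simple_graph :: "'a set \<Rightarrow> 'a set set \<Rightarrow> bool" where
  "simple_graph V E \<longleftrightarrow> finite V \<and> (\<forall>e\<in>E. \<exists>v w. e = {v, w} \<and> v \<in> V \<and> w \<in> V \<and> v \<noteq> w)"

definition adj :: "'a set set \<Rightarrow> 'a \<Rightarrow> 'a \<Rightarrow> bool" where
  "adj E v w \<longleftrightarrow> {v, w} \<in> E"

definition connected_graph :: "'a set \<Rightarrow> 'a set set \<Rightarrow> bool" where
  "connected_graph V E \<longleftrightarrow> (\<forall>v\<in>V. \<forall>w\<in>V. \<exists>n. (adj E ^^ n) v w)"

definition gdist :: "'a set set \<Rightarrow> 'a \<Rightarrow> 'a \<Rightarrow> nat" where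
  "gdist E v w = (LEAST n. (adj E ^^ n) v w)"

definition gball :: "'a set \<Rightarrow> 'a set set \<Rightarrow> 'a \<Rightarrow> nat \<Rightarrow> 'a set" where
  "gball V E v r = {w \<in> V. gdist E v w \<le> r}"

definition maxop :: "'a set \<Rightarrow> 'a set set \<Rightarrow> ('a \<Rightarrow> real) \<Rightarrow> 'a \<Rightarrow> real" where
  "maxop V E f v = Max ((\<lambda>r. (\<Sum>w\<in>gball V E v r. \<bar>f w\<bar>) / real (card (gball V E v r))) ` UNIV)"

text \<open>Variation: sum over edges (each counted once) of |f v - f w|; for an edge e = {v,w}
  this equals Max (f ` e) - Min (f ` e).\<close>
definition gvar :: "'a set set \<Rightarrow> ('a \<Rightarrow> real) \<Rightarrow> real" where
  "gvar E f = (\<Sum>e\<in>E. Max (f ` e) - Min (f ` e))"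

definition CG :: "'a set \<Rightarrow> 'a set set \<Rightarrow> ereal" where
  "CG V E = Inf {c::ereal. 0 \<le> c \<and> (\<forall>f::'a \<Rightarrow> real. ereal (gvar E (maxop V E f)) \<le> c * ereal (gvar E f))}"

end

theory Submission
  imports Defs
begin

text \<open>
  Up to relabelling there are six connected graphs on four vertices. For each of them the maximal
  function of a nonnegative \<open>f\<close> is, at every vertex, the maximum of at most four averages, the
  last one being the mean of \<open>f\<close>, so the upper bound is a piecewise linear inequality in the
  four values of \<open>f\<close>. Passing from \<open>f\<close> to its absolute value only decreases the variation.
  The bound is attained at the indicator function of a vertex; whenever all neighbours of
  that vertex are adjacent to every other vertex, the maximal function is 1 there and 1/4 elsewhere.
\<close>

section \<open>Edges, variation and the best constant\<close>

lemma simple_graph_edgeD: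
  assumes "simple_graph V E" and "{u, w} \<in> E"
  shows "u \<in> V \<and> w \<in> V \<and> u \<noteq> w"
  using assms unfolding simple_graph_def by (metis doubleton_eq_iff)

lemma Max_Min_doubleton: "Max (f ` {v, w}) - Min (f ` {v, w}) = \<bar>f v - f w :: real\<bar>"
  by (simp add: max_def min_def)

lemma gvar_empty: "gvar {} f = 0"
  by (simp add: gvar_def)

lemma gvar_insert:
  assumes "finite E" and "{v, w} \<notin> E"
  shows "gvar (insert {v, w} E) f = \<bar>f v - f w\<bar> + gvar E f"
  using assms Max_Min_doubleton[of f v w] by (simp add: gvar_def)

text \<open>Edge by edge this is the reverse triangle inequality. As \<open>maxop\<close> sees only
  absolute values, the upper bound need only be proved for nonnegative functions.\<close>

lemma gvar_abs_le:
  assumes "simple_graph V E"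
  shows "gvar E (\<lambda>v. \<bar>f v\<bar>) \<le> gvar E f"
  unfolding gvar_def
proof (rule sum_mono)
  fix e assume "e \<in> E"
  with assms obtain v w where "e = {v, w}"
    unfolding simple_graph_def by blast
  then show "Max ((\<lambda>v. \<bar>f v\<bar>) ` e) - Min ((\<lambda>v. \<bar>f v\<bar>) ` e) \<le> Max (f ` e) - Min (f ` e)"
    using Max_Min_doubleton[of f v w] Max_Min_doubleton[of "\<lambda>v. \<bar>f v\<bar>" v w]
      abs_triangle_ineq3[of "f v" "f w"] by simp
qed

text \<open>Testing an admissible constant on the extremal function \<open>g\<close> and cancelling
  its positive variation gives the lower bound; the upper bound passes from the absolute value to
  \<open>f\<close> itself by \<open>gvar_abs_le\<close>.\<close>

lemma CG_eqI:
  assumes graph: "simple_graph V E" and "0 \<le> C"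
    and upper: "\<And>f. (\<And>v. 0 \<le> f v) \<Longrightarrow> gvar E (maxop V E f) \<le> C * gvar E f"
    and pos: "0 < gvar E g" and attained: "C * gvar E g \<le> gvar E (maxop V E g)"
  shows "CG V E = ereal C"
  unfolding CG_def
proof (rule antisym)
  have "gvar E (maxop V E f) \<le> C * gvar E f" for f
  proof -
    have "gvar E (maxop V E f) = gvar E (maxop V E (\<lambda>v. \<bar>f v\<bar>))"
      by (simp add: maxop_def[abs_def])
    also have "\<dots> \<le> C * gvar E (\<lambda>v. \<bar>f v\<bar>)"
      by (rule upper) simp
    also have "\<dots> \<le> C * gvar E f"
      using gvar_abs_le[OF graph] \<open>0 \<le> C\<close> by (rule mult_left_mono)
    finally show ?thesis .
  qed
  then show "Inf {c. 0 \<le> c \<and> (\<forall>f. ereal (gvar E (maxop V E f)) \<le> c * ereal (gvar E f))} \<le> ereal C"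
    using \<open>0 \<le> C\<close> by (intro Inf_lower) simp
  show "ereal C \<le> Inf {c. 0 \<le> c \<and> (\<forall>f. ereal (gvar E (maxop V E f)) \<le> c * ereal (gvar E f))}"
  proof (rule Inf_greatest)
    fix c :: ereal
    assume c: "c \<in> {c. 0 \<le> c \<and> (\<forall>f. ereal (gvar E (maxop V E f)) \<le> c * ereal (gvar E f))}"
    show "ereal C \<le> c"
    \<comment> \<open>Only a finite \<open>c\<close> needs \<open>g\<close>: infinity is above
      everything and minus infinity is excluded by \<open>0 \<le> c\<close>.\<close>
    proof (cases c)
      case (real r)
      with c have "gvar E (maxop V E g) \<le> r * gvar E g"
        by auto
      with attained have "C * gvar E g \<le> r * gvar E g"
        by linarith
      with pos real show ?thesis
        by simp
    qed (use c in auto)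
  qed
qed

section \<open>Distance and balls in a connected graph\<close>

text \<open>\<open>LEAST\<close> is meaningful only if some walk exists; connectedness supplies one,
  so the minimum is attained.\<close>

lemma gdist_le_iff:
  assumes "connected_graph V E" "v \<in> V" "w \<in> V"
  shows "gdist E v w \<le> r \<longleftrightarrow> (\<exists>n\<le>r. (adj E ^^ n) v w)"
proof -
  have "\<exists>n. (adj E ^^ n) v w"
    using assms unfolding connected_graph_def by blast
  then have "(adj E ^^ gdist E v w) v w"
    unfolding gdist_def by (rule LeastI_ex)
  then show ?thesis
    unfolding gdist_def by (meson Least_le order.trans)
qed

lemma gball_0:
  assumes "connected_graph V E" "v \<in> V"
  shows "gball V E v 0 = {v}"
  using gdist_le_iff[OF assms, of _ 0] assms(2) by (auto simp: gball_def)

text \<open>Breadth-first search: a walk of \<open>r + 1\<close> steps is a walk of \<open>r\<close>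
  steps followed by one edge. Balls of explicit graphs become computable without evaluating
  \<open>gdist\<close>.\<close>

lemma gball_Suc:
  assumes "simple_graph V E" "connected_graph V E" "v \<in> V"
  shows "gball V E v (Suc r) = {w \<in> V. w \<in> gball V E v r \<or> (\<exists>u\<in>gball V E v r. {u, w} \<in> E)}"
proof -
  have step: "(\<exists>n\<le>Suc r. (adj E ^^ n) v w) \<longleftrightarrow>
      (\<exists>n\<le>r. (adj E ^^ n) v w) \<or> (\<exists>u\<in>V. (\<exists>n\<le>r. (adj E ^^ n) v u) \<and> {u, w} \<in> E)" for w
  proof -
    have inV: "u \<in> V" if "{u, w} \<in> E" for u
      using simple_graph_edgeD[OF assms(1) that] by blast
    show ?thesis
    proof
      assume "\<exists>n\<le>Suc r. (adj E ^^ n) v w"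
      then obtain n where n: "n \<le> Suc r" "(adj E ^^ n) v w" by blast
      then consider "n \<le> r" | "n = Suc r" by linarith
      then show "(\<exists>n\<le>r. (adj E ^^ n) v w) \<or> (\<exists>u\<in>V. (\<exists>n\<le>r. (adj E ^^ n) v u) \<and> {u, w} \<in> E)"
      proof cases
        case 2
        with n obtain u where "(adj E ^^ r) v u" "{u, w} \<in> E"
          by (auto simp: adj_def)
        with inV show ?thesis by blast
      qed (use n in blast)
    next
      assume "(\<exists>n\<le>r. (adj E ^^ n) v w) \<or> (\<exists>u\<in>V. (\<exists>n\<le>r. (adj E ^^ n) v u) \<and> {u, w} \<in> E)"
      then show "\<exists>n\<le>Suc r. (adj E ^^ n) v w"
      proof
        assume "\<exists>u\<in>V. (\<exists>n\<le>r. (adj E ^^ n) v u) \<and> {u, w} \<in> E"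
        then obtain u n where "n \<le> r" "(adj E ^^ n) v u" "{u, w} \<in> E" by blast
        then have "Suc n \<le> Suc r" "(adj E ^^ Suc n) v w"
          by (auto simp: adj_def)
        then show ?thesis by blast
      qed (use le_SucI in blast)
    qed
  qed
  have ball: "gball V E v s = {w \<in> V. \<exists>n\<le>s. (adj E ^^ n) v w}" for s
    using gdist_le_iff[OF assms(2,3)] by (auto simp: gball_def)
  show ?thesis
    unfolding ball step by blast
qed

section \<open>The maximal operator as a finite maximum\<close>

text \<open>Separates the average from the radius, so that radii with equal balls visibly give equal
  values.\<close>

definition ball_avg :: "('a \<Rightarrow> real) \<Rightarrow> 'a set \<Rightarrow> real" where
  "ball_avg f B = (\<Sum>w\<in>B. \<bar>f w\<bar>) / real (card B)"

lemma gball_full_mono: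
  assumes "gball V E v r = V" and "r \<le> s"
  shows "gball V E v s = V"
  using assms unfolding gball_def by (auto dest: order.trans)

text \<open>Balls stop growing once they exhaust \<open>V\<close>, so only the radii 0 to 3 matter.
  No connected graph on four vertices needs more, and the ends of the path need all of them.\<close>

lemma maxop_radius_3:
  assumes "connected_graph V E" "v \<in> V" and full: "gball V E v 3 = V"
  shows "maxop V E f v =
    max \<bar>f v\<bar> (max (ball_avg f (gball V E v 1)) (max (ball_avg f (gball V E v 2)) (ball_avg f V)))"
proof -
  have "(\<lambda>r. ball_avg f (gball V E v r)) ` {3..} = {ball_avg f V}"
    using gball_full_mono[OF full] by force
  moreover have "UNIV = {0, 1, 2} \<union> {3::nat..}"
    by auto
  then have "range h = {h 0, h 1, h 2} \<union> h ` {3..}" for h :: "nat \<Rightarrow> real"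
    by (metis image_Un image_empty image_insert)
  ultimately have "range (\<lambda>r. ball_avg f (gball V E v r)) =
      {ball_avg f {v}, ball_avg f (gball V E v 1), ball_avg f (gball V E v 2), ball_avg f V}"
    using gball_0[OF assms(1,2)] by (simp add: insert_commute)
  then show ?thesis
    \<comment> \<open>Folding \<open>ball_avg\<close> exposes the four-element set above; unfolding
      it afterwards evaluates the average over the singleton.\<close>
    by (simp add: maxop_def flip: ball_avg_def) (simp add: ball_avg_def)
qed

lemma maxop_radius_2:
  assumes "connected_graph V E" "v \<in> V" and full: "gball V E v 2 = V"
  shows "maxop V E f v = max \<bar>f v\<bar> (max (ball_avg f (gball V E v 1)) (ball_avg f V))"
  using maxop_radius_3[OF assms(1,2)] gball_full_mono[OF full, of 3] full by simp

lemma maxop_radius_1: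
  assumes "connected_graph V E" "v \<in> V" and full: "gball V E v 1 = V"
  shows "maxop V E f v = max \<bar>f v\<bar> (ball_avg f V)"
  using maxop_radius_2[OF assms(1,2)] gball_full_mono[OF full, of 2] full by simp

text \<open>A walk from a vertex inside \<open>S\<close> to one outside must cross the boundary at
  some step.\<close>

lemma connected_graph_cut:
  assumes graph: "simple_graph V E" "connected_graph V E"
    and S: "S \<subseteq> V" "S \<noteq> {}" "S \<noteq> V"
  obtains u w where "u \<in> S" "w \<in> V - S" "{u, w} \<in> E"
proof -
  obtain s t where st: "s \<in> S" "t \<in> V - S"
    using S by blast
  with graph S obtain n where "(adj E ^^ n) s t"
    unfolding connected_graph_def by blast
  then have "\<exists>u\<in>S. \<exists>w. w \<notin> S \<and> {u, w} \<in> E"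
    using st(2)
  proof (induction n arbitrary: t)
    case 0
    with st(1) show ?case by simp
  next
    case (Suc n)
    then obtain u where u: "(adj E ^^ n) s u" "{u, t} \<in> E"
      by (metis adj_def relpowp_Suc_E)
    then have "u \<in> V"
      using simple_graph_edgeD[OF graph(1)] by blast
    \<comment> \<open>If \<open>u\<close> is in \<open>S\<close>, the last edge crosses; otherwise
      the induction hypothesis applies to \<open>u\<close>.\<close>
    then show ?case
      using Suc u by blast
  qed
  then obtain u w where uw: "u \<in> S" "w \<notin> S" "{u, w} \<in> E"
    by blast
  moreover have "w \<in> V"
    using simple_graph_edgeD[OF graph(1) uw(3)] by blast
  ultimately show ?thesis
    using that by blast
qed

lemma gball_1:
  assumes "simple_graph V E" "connected_graph V E" "v \<in> V"
  shows "gball V E v 1 = {w \<in> V. w = v \<or> {v, w} \<in> E}"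
  using gball_Suc[OF assms, of 0] gball_0[OF assms(2,3)] by auto

text \<open>With larger balls as unions of closed neighbourhoods, a table of the balls of radius one
  determines all others without returning to \<open>E\<close>.\<close>

lemma gball_add_1:
  assumes "simple_graph V E" "connected_graph V E" "v \<in> V"
  shows "gball V E v (Suc r) = (\<Union>u\<in>gball V E v r. gball V E u 1)"
proof -
  have "gball V E v r \<subseteq> V"
    by (auto simp: gball_def)
  then have "(\<Union>u\<in>gball V E v r. gball V E u 1) =
      (\<Union>u\<in>gball V E v r. {w \<in> V. w = u \<or> {u, w} \<in> E})"
    using gball_1[OF assms(1,2)] by (intro SUP_cong) auto
  with \<open>gball V E v r \<subseteq> V\<close> show ?thesis
    unfolding gball_Suc[OF assms] by blast
qed

lemma gball_2_3:
  assumes "simple_graph V E" "connected_graph V E" "v \<in> V"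
  shows "gball V E v 2 = (\<Union>u\<in>gball V E v 1. gball V E u 1)"
    and "gball V E v 3 = (\<Union>u\<in>gball V E v 2. gball V E u 1)"
  using gball_add_1[OF assms] by (simp_all add: numeral_eq_Suc)

lemma ball_avg_2: "x \<noteq> y \<Longrightarrow> ball_avg f {x, y} = (\<bar>f x\<bar> + \<bar>f y\<bar>) / 2"
  by (simp add: ball_avg_def)

lemma ball_avg_3:
  "distinct [x, y, z] \<Longrightarrow> ball_avg f {x, y, z} = (\<bar>f x\<bar> + \<bar>f y\<bar> + \<bar>f z\<bar>) / 3"
  by (simp add: ball_avg_def)

section \<open>Piecewise linear inequalities for the six graphs\<close>

lemma max2_cases: "x = max p q \<Longrightarrow> p \<le> x \<and> q \<le> x \<and> (x = p \<or> x = q)"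
  for x :: real
  by (auto simp: max_def)

text \<open>The quotients are cleared so that only linear facts with integer coefficients remain.\<close>

lemma max3_cases:
  "x = max p (max (q / 2) r) \<Longrightarrow>
    p \<le> x \<and> q \<le> 2 * x \<and> r \<le> x \<and> (x = p \<or> 2 * x = q \<or> x = r)"
  "x = max p (max (q / 3) r) \<Longrightarrow>
    p \<le> x \<and> q \<le> 3 * x \<and> r \<le> x \<and> (x = p \<or> 3 * x = q \<or> x = r)"
  for x :: real
  by (auto simp: max_def)

lemma max4_cases:
  "x = max p (max (q / 2) (max (s / 3) r)) \<Longrightarrow>
    p \<le> x \<and> q \<le> 2 * x \<and> s \<le> 3 * x \<and> r \<le> x \<and>
    (x = p \<or> 2 * x = q \<or> 3 * x = s \<or> x = r)"
  for x :: real
  by (auto simp: max_def)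

text \<open>Every ball of radius one is everything, so the maximal function is \<open>f\<close> cut
  off from below at its mean. After splitting on the term attaining each maximum and on the signs in
  the absolute values, only linear arithmetic remains; the next five lemmas are proved in the same
  way.\<close>

lemma variation_le_K4:
  fixes a b c d m :: real
  assumes "m = (a + b + c + d) / 4"
    and "A = max a m"
    and "B = max b m"
    and "C = max c m"
    and "D = max d m"
  shows "\<bar>A - B\<bar> + \<bar>A - C\<bar> + \<bar>A - D\<bar> + \<bar>B - C\<bar> + \<bar>B - D\<bar> + \<bar>C - D\<bar>
    \<le> 3/4 * (\<bar>a - b\<bar> + \<bar>a - c\<bar> + \<bar>a - d\<bar> + \<bar>b - c\<bar> + \<bar>b - d\<bar> + \<bar>c - d\<bar>)"
proof -
  have "4 * m = a + b + c + d"
    using assms(1) by simp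
  \<comment> \<open>The factor 3/4 is split into 4 on one side and 3 on the other to keep integer
    coefficients.\<close>
  then have "4 * (\<bar>A - B\<bar> + \<bar>A - C\<bar> + \<bar>A - D\<bar> + \<bar>B - C\<bar> + \<bar>B - D\<bar> + \<bar>C - D\<bar>)
      \<le> 3 * (\<bar>a - b\<bar> + \<bar>a - c\<bar> + \<bar>a - d\<bar> + \<bar>b - c\<bar> + \<bar>b - d\<bar> + \<bar>c - d\<bar>)"
    using max2_cases[OF assms(2)] max2_cases[OF assms(3)]
      max2_cases[OF assms(4)] max2_cases[OF assms(5)]
    using [[smt_timeout = 300]] by (smt (verit))
  then show ?thesis
    by simp
qed

text \<open>\<open>a\<close> is the centre; a leaf sees only itself and the centre at radius one,
  and everything at radius two.\<close>

lemma variation_le_star: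
  fixes a b c d m :: real
  assumes "m = (a + b + c + d) / 4"
    and "A = max a m"
    and "B = max b (max ((a + b) / 2) m)"
    and "C = max c (max ((a + c) / 2) m)"
    and "D = max d (max ((a + d) / 2) m)"
  shows "\<bar>A - B\<bar> + \<bar>A - C\<bar> + \<bar>A - D\<bar>
    \<le> 3/4 * (\<bar>a - b\<bar> + \<bar>a - c\<bar> + \<bar>a - d\<bar>)"
proof -
  have "4 * m = a + b + c + d"
    using assms(1) by simp
  then have "4 * (\<bar>A - B\<bar> + \<bar>A - C\<bar> + \<bar>A - D\<bar>)
      \<le> 3 * (\<bar>a - b\<bar> + \<bar>a - c\<bar> + \<bar>a - d\<bar>)"
    using max2_cases[OF assms(2)] max3_cases(1)[OF assms(3)]
      max3_cases(1)[OF assms(4)] max3_cases(1)[OF assms(5)]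
    using [[smt_timeout = 300]] by (smt (verit))
  then show ?thesis
    by simp
qed

text \<open>\<open>a\<close> has degree three, \<open>b\<close> is the pendant vertex, and
  \<open>c\<close>, \<open>d\<close> share the triangle as their ball of radius one.\<close>

lemma variation_le_paw:
  fixes a b c d m :: real
  assumes "m = (a + b + c + d) / 4"
    and "A = max a m"
    and "B = max b (max ((a + b) / 2) m)"
    and "C = max c (max ((a + c + d) / 3) m)"
    and "D = max d (max ((a + c + d) / 3) m)"
  shows "\<bar>A - B\<bar> + \<bar>A - C\<bar> + \<bar>A - D\<bar> + \<bar>C - D\<bar>
    \<le> 3/4 * (\<bar>a - b\<bar> + \<bar>a - c\<bar> + \<bar>a - d\<bar> + \<bar>c - d\<bar>)"
proof -
  have "4 * m = a + b + c + d"
    using assms(1) by simp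
  then have "4 * (\<bar>A - B\<bar> + \<bar>A - C\<bar> + \<bar>A - D\<bar> + \<bar>C - D\<bar>)
      \<le> 3 * (\<bar>a - b\<bar> + \<bar>a - c\<bar> + \<bar>a - d\<bar> + \<bar>c - d\<bar>)"
    using max2_cases[OF assms(2)] max3_cases(1)[OF assms(3)]
      max3_cases(2)[OF assms(4)] max3_cases(2)[OF assms(5)]
    using [[smt_timeout = 300]] by (smt (verit))
  then show ?thesis
    by simp
qed

text \<open>\<open>a\<close> and \<open>b\<close> have degree three; \<open>c\<close> and
  \<open>d\<close> are the nonadjacent pair.\<close>

lemma variation_le_diamond:
  fixes a b c d m :: real
  assumes "m = (a + b + c + d) / 4"
    and "A = max a m"
    and "B = max b m"
    and "C = max c (max ((a + b + c) / 3) m)"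
    and "D = max d (max ((a + b + d) / 3) m)"
  shows "\<bar>A - B\<bar> + \<bar>A - C\<bar> + \<bar>A - D\<bar> + \<bar>B - C\<bar> + \<bar>B - D\<bar>
    \<le> 3/4 * (\<bar>a - b\<bar> + \<bar>a - c\<bar> + \<bar>a - d\<bar> + \<bar>b - c\<bar> + \<bar>b - d\<bar>)"
proof -
  have "4 * m = a + b + c + d"
    using assms(1) by simp
  then have "4 * (\<bar>A - B\<bar> + \<bar>A - C\<bar> + \<bar>A - D\<bar> + \<bar>B - C\<bar> + \<bar>B - D\<bar>)
      \<le> 3 * (\<bar>a - b\<bar> + \<bar>a - c\<bar> + \<bar>a - d\<bar> + \<bar>b - c\<bar> + \<bar>b - d\<bar>)"
    using max2_cases[OF assms(2)] max2_cases[OF assms(3)]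
      max3_cases(2)[OF assms(4)] max3_cases(2)[OF assms(5)]
    using [[smt_timeout = 300]] by (smt (verit))
  then show ?thesis
    by simp
qed

text \<open>In the cyclic order \<open>a\<close>, \<open>b\<close>, \<open>c\<close>,
  \<open>d\<close>, each ball of radius one misses only the opposite vertex.\<close>

lemma variation_le_C4:
  fixes a b c d m :: real
  assumes "m = (a + b + c + d) / 4"
    and "A = max a (max ((a + b + d) / 3) m)"
    and "B = max b (max ((a + b + c) / 3) m)"
    and "C = max c (max ((b + c + d) / 3) m)"
    and "D = max d (max ((a + c + d) / 3) m)"
  shows "\<bar>A - B\<bar> + \<bar>B - C\<bar> + \<bar>C - D\<bar> + \<bar>A - D\<bar>
    \<le> 3/4 * (\<bar>a - b\<bar> + \<bar>b - c\<bar> + \<bar>c - d\<bar> + \<bar>a - d\<bar>)"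
proof -
  have "4 * m = a + b + c + d"
    using assms(1) by simp
  then have "4 * (\<bar>A - B\<bar> + \<bar>B - C\<bar> + \<bar>C - D\<bar> + \<bar>A - D\<bar>)
      \<le> 3 * (\<bar>a - b\<bar> + \<bar>b - c\<bar> + \<bar>c - d\<bar> + \<bar>a - d\<bar>)"
    using max3_cases(2)[OF assms(2)] max3_cases(2)[OF assms(3)]
      max3_cases(2)[OF assms(4)] max3_cases(2)[OF assms(5)]
    using [[smt_timeout = 300]] by (smt (verit))
  then show ?thesis
    by simp
qed

text \<open>Only the two ends need all four radii; the inner vertices reach everything in two
  steps.\<close>

lemma variation_le_P4:
  fixes a b c d m :: real
  assumes "m = (a + b + c + d) / 4"
    and "A = max a (max ((a + b) / 2) (max ((a + b + c) / 3) m))"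
    and "B = max b (max ((a + b + c) / 3) m)"
    and "C = max c (max ((b + c + d) / 3) m)"
    and "D = max d (max ((c + d) / 2) (max ((b + c + d) / 3) m))"
  shows "\<bar>A - B\<bar> + \<bar>B - C\<bar> + \<bar>C - D\<bar>
    \<le> 3/4 * (\<bar>a - b\<bar> + \<bar>b - c\<bar> + \<bar>c - d\<bar>)"
proof -
  have "4 * m = a + b + c + d"
    using assms(1) by simp
  then have "4 * (\<bar>A - B\<bar> + \<bar>B - C\<bar> + \<bar>C - D\<bar>)
      \<le> 3 * (\<bar>a - b\<bar> + \<bar>b - c\<bar> + \<bar>c - d\<bar>)"
    using max4_cases[OF assms(2)] max3_cases(2)[OF assms(3)]
      max3_cases(2)[OF assms(4)] max4_cases[OF assms(5)]
    using [[smt_timeout = 300]] by (smt (verit))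
  then show ?thesis
    by simp
qed

section \<open>The six graphs with labelled vertices\<close>

text \<open>Named vertices let the edge set be written out. The labels are in no particular order,
  so one graph can be interpreted under several labellings.\<close>

locale four_vertices =
  fixes V :: "'a set" and E :: "'a set set" and a b c d :: 'a
  assumes graph: "simple_graph V E" "connected_graph V E"
    and V: "V = {a, b, c, d}" and dist: "distinct [a, b, c, d]"
begin

abbreviation mean :: "('a \<Rightarrow> real) \<Rightarrow> real" where
  "mean f \<equiv> (f a + f b + f c + f d) / 4"

lemma mem: "a \<in> V" "b \<in> V" "c \<in> V" "d \<in> V"
  by (simp_all add: V)

lemma neq:
  "a \<noteq> b" "a \<noteq> c" "a \<noteq> d" "b \<noteq> c" "b \<noteq> d" "c \<noteq> d"
  "b \<noteq> a" "c \<noteq> a" "d \<noteq> a" "c \<noteq> b" "d \<noteq> b" "d \<noteq> c"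
  using dist by auto

lemmas nbhd_eqs = mem[THEN gball_1[OF graph]]
lemmas ball2_eqs = mem[THEN gball_2_3(1)[OF graph]]
lemmas ball3_eqs = mem[THEN gball_2_3(2)[OF graph]]
lemmas maxop_eqs = maxop_radius_1[OF graph(2)] maxop_radius_2[OF graph(2)] maxop_radius_3[OF graph(2)]

lemma ball_avg_V: "ball_avg f V = mean (\<lambda>v. \<bar>f v\<bar>)"
  using dist by (simp add: ball_avg_def V)

lemma CG_K4:
  assumes E: "E = {{a, b}, {a, c}, {a, d}, {b, c}, {b, d}, {c, d}}"
  shows "CG V E = ereal (3/4)"
proof (rule CG_eqI[OF graph(1)])
  have var: "gvar E f = \<bar>f a - f b\<bar> + \<bar>f a - f c\<bar> + \<bar>f a - f d\<bar> + \<bar>f b - f c\<bar> + \<bar>f b - f d\<bar> + \<bar>f c - f d\<bar>" for f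
    using neq unfolding E by (simp add: gvar_insert gvar_empty doubleton_eq_iff)
  have nbhd: "gball V E a 1 = V" "gball V E b 1 = V"
      "gball V E c 1 = V" "gball V E d 1 = V"
    unfolding nbhd_eqs using dist by (auto simp: V E doubleton_eq_iff)
  have M: "maxop V E f a = max (f a) (mean f)"
      "maxop V E f b = max (f b) (mean f)"
      "maxop V E f c = max (f c) (mean f)"
      "maxop V E f d = max (f d) (mean f)"
    if "\<And>v. 0 \<le> f v" for f
    using neq mem that nbhd
    by (simp_all add: maxop_eqs ball_avg_V ball_avg_2 ball_avg_3)
  show "gvar E (maxop V E f) \<le> 3/4 * gvar E f" if "\<And>v. 0 \<le> f v" for f
    using variation_le_K4[OF refl M[of f, OF that]] by (simp add: var)
  \<comment> \<open>Under the maximal operator each of the three edges at \<open>a\<close> falls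
    from 1 to 1 - 1/4, and the other edges stay at 0.\<close>
  show "0 < gvar E (\<lambda>v. if v = a then 1 else 0)"
    using neq by (simp add: var)
  show "3/4 * gvar E (\<lambda>v. if v = a then 1 else 0) \<le> gvar E (maxop V E (\<lambda>v. if v = a then 1 else 0))"
    using neq by (simp add: var M)
qed simp

lemma CG_star:
  assumes E: "E = {{a, b}, {a, c}, {a, d}}"
  shows "CG V E = ereal (3/4)"
proof (rule CG_eqI[OF graph(1)])
  have var: "gvar E f = \<bar>f a - f b\<bar> + \<bar>f a - f c\<bar> + \<bar>f a - f d\<bar>" for f
    using neq unfolding E by (simp add: gvar_insert gvar_empty doubleton_eq_iff)
  have nbhd: "gball V E a 1 = V" "gball V E b 1 = {a, b}"
      "gball V E c 1 = {a, c}" "gball V E d 1 = {a, d}"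
    unfolding nbhd_eqs using dist by (auto simp: V E doubleton_eq_iff)
  have ball2: "gball V E b 2 = V" "gball V E c 2 = V"
      "gball V E d 2 = V"
    unfolding ball2_eqs nbhd UN_insert UN_empty by (auto simp: V)
  have M: "maxop V E f a = max (f a) (mean f)"
      "maxop V E f b = max (f b) (max ((f a + f b) / 2) (mean f))"
      "maxop V E f c = max (f c) (max ((f a + f c) / 2) (mean f))"
      "maxop V E f d = max (f d) (max ((f a + f d) / 2) (mean f))"
    if "\<And>v. 0 \<le> f v" for f
    using neq mem that nbhd ball2
    by (simp_all add: maxop_eqs ball_avg_V ball_avg_2 ball_avg_3)
  show "gvar E (maxop V E f) \<le> 3/4 * gvar E f" if "\<And>v. 0 \<le> f v" for f
    using variation_le_star[OF refl M[of f, OF that]] by (simp add: var)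
  \<comment> \<open>The indicator of the centre would give only the ratio 1/2, because every leaf
    would then average to 1/2. With the leaf \<open>b\<close>, all other vertices get 1/4.\<close>
  show "0 < gvar E (\<lambda>v. if v = b then 1 else 0)"
    using neq by (simp add: var)
  show "3/4 * gvar E (\<lambda>v. if v = b then 1 else 0) \<le> gvar E (maxop V E (\<lambda>v. if v = b then 1 else 0))"
    using neq by (simp add: var M)
qed simp

lemma CG_paw:
  assumes E: "E = {{a, b}, {a, c}, {a, d}, {c, d}}"
  shows "CG V E = ereal (3/4)"
proof (rule CG_eqI[OF graph(1)])
  have var: "gvar E f = \<bar>f a - f b\<bar> + \<bar>f a - f c\<bar> + \<bar>f a - f d\<bar> + \<bar>f c - f d\<bar>" for f
    using neq unfolding E by (simp add: gvar_insert gvar_empty doubleton_eq_iff)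
  have nbhd: "gball V E a 1 = V" "gball V E b 1 = {a, b}"
      "gball V E c 1 = {a, c, d}" "gball V E d 1 = {a, c, d}"
    unfolding nbhd_eqs using dist by (auto simp: V E doubleton_eq_iff)
  have ball2: "gball V E b 2 = V" "gball V E c 2 = V"
      "gball V E d 2 = V"
    unfolding ball2_eqs nbhd UN_insert UN_empty by (auto simp: V)
  have M: "maxop V E f a = max (f a) (mean f)"
      "maxop V E f b = max (f b) (max ((f a + f b) / 2) (mean f))"
      "maxop V E f c = max (f c) (max ((f a + f c + f d) / 3) (mean f))"
      "maxop V E f d = max (f d) (max ((f a + f c + f d) / 3) (mean f))"
    if "\<And>v. 0 \<le> f v" for f
    using neq mem that nbhd ball2
    by (simp_all add: maxop_eqs ball_avg_V ball_avg_2 ball_avg_3)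
  show "gvar E (maxop V E f) \<le> 3/4 * gvar E f" if "\<And>v. 0 \<le> f v" for f
    using variation_le_paw[OF refl M[of f, OF that]] by (simp add: var)
  \<comment> \<open>Besides \<open>b\<close>, only \<open>a\<close> has \<open>b\<close> in its ball
    of radius one, and that ball is \<open>V\<close>; so the value is 1/4 away from
    \<open>b\<close>.\<close>
  show "0 < gvar E (\<lambda>v. if v = b then 1 else 0)"
    using neq by (simp add: var)
  show "3/4 * gvar E (\<lambda>v. if v = b then 1 else 0) \<le> gvar E (maxop V E (\<lambda>v. if v = b then 1 else 0))"
    using neq by (simp add: var M)
qed simp

lemma CG_diamond:
  assumes E: "E = {{a, b}, {a, c}, {a, d}, {b, c}, {b, d}}"
  shows "CG V E = ereal (3/4)"
proof (rule CG_eqI[OF graph(1)])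
  have var: "gvar E f = \<bar>f a - f b\<bar> + \<bar>f a - f c\<bar> + \<bar>f a - f d\<bar> + \<bar>f b - f c\<bar> + \<bar>f b - f d\<bar>" for f
    using neq unfolding E by (simp add: gvar_insert gvar_empty doubleton_eq_iff)
  have nbhd: "gball V E a 1 = V" "gball V E b 1 = V"
      "gball V E c 1 = {a, b, c}" "gball V E d 1 = {a, b, d}"
    unfolding nbhd_eqs using dist by (auto simp: V E doubleton_eq_iff)
  have ball2: "gball V E c 2 = V" "gball V E d 2 = V"
    unfolding ball2_eqs nbhd UN_insert UN_empty by (auto simp: V)
  have M: "maxop V E f a = max (f a) (mean f)"
      "maxop V E f b = max (f b) (mean f)"
      "maxop V E f c = max (f c) (max ((f a + f b + f c) / 3) (mean f))"
      "maxop V E f d = max (f d) (max ((f a + f b + f d) / 3) (mean f))"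
    if "\<And>v. 0 \<le> f v" for f
    using neq mem that nbhd ball2
    by (simp_all add: maxop_eqs ball_avg_V ball_avg_2 ball_avg_3)
  show "gvar E (maxop V E f) \<le> 3/4 * gvar E f" if "\<And>v. 0 \<le> f v" for f
    using variation_le_diamond[OF refl M[of f, OF that]] by (simp add: var)
  show "0 < gvar E (\<lambda>v. if v = c then 1 else 0)"
    using neq by (simp add: var)
  show "3/4 * gvar E (\<lambda>v. if v = c then 1 else 0) \<le> gvar E (maxop V E (\<lambda>v. if v = c then 1 else 0))"
    using neq by (simp add: var M)
qed simp

lemma CG_C4:
  assumes E: "E = {{a, b}, {b, c}, {c, d}, {a, d}}"
  shows "CG V E = ereal (3/4)"
proof (rule CG_eqI[OF graph(1)])
  have var: "gvar E f = \<bar>f a - f b\<bar> + \<bar>f b - f c\<bar> + \<bar>f c - f d\<bar> + \<bar>f a - f d\<bar>" for f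
    using neq unfolding E by (simp add: gvar_insert gvar_empty doubleton_eq_iff)
  have nbhd: "gball V E a 1 = {a, b, d}" "gball V E b 1 = {a, b, c}"
      "gball V E c 1 = {b, c, d}" "gball V E d 1 = {a, c, d}"
    unfolding nbhd_eqs using dist by (auto simp: V E doubleton_eq_iff)
  have ball2: "gball V E a 2 = V" "gball V E b 2 = V"
      "gball V E c 2 = V" "gball V E d 2 = V"
    unfolding ball2_eqs nbhd UN_insert UN_empty by (auto simp: V)
  have M: "maxop V E f a = max (f a) (max ((f a + f b + f d) / 3) (mean f))"
      "maxop V E f b = max (f b) (max ((f a + f b + f c) / 3) (mean f))"
      "maxop V E f c = max (f c) (max ((f b + f c + f d) / 3) (mean f))"
      "maxop V E f d = max (f d) (max ((f a + f c + f d) / 3) (mean f))"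
    if "\<And>v. 0 \<le> f v" for f
    using neq mem that nbhd ball2
    by (simp_all add: maxop_eqs ball_avg_V ball_avg_2 ball_avg_3)
  show "gvar E (maxop V E f) \<le> 3/4 * gvar E f" if "\<And>v. 0 \<le> f v" for f
    using variation_le_C4[OF refl M[of f, OF that]] by (simp add: var)
  \<comment> \<open>The neighbours of \<open>a\<close> get 1/3, not 1/4, but the values 1, 1/3, 1/4
    decrease along both paths from \<open>a\<close> to \<open>c\<close>, so the variation telescopes
    to twice 3/4.\<close>
  show "0 < gvar E (\<lambda>v. if v = a then 1 else 0)"
    using neq by (simp add: var)
  show "3/4 * gvar E (\<lambda>v. if v = a then 1 else 0) \<le> gvar E (maxop V E (\<lambda>v. if v = a then 1 else 0))"
    using neq by (simp add: var M)
qed simp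

lemma CG_P4:
  assumes E: "E = {{a, b}, {b, c}, {c, d}}"
  shows "CG V E = ereal (3/4)"
proof (rule CG_eqI[OF graph(1)])
  have var: "gvar E f = \<bar>f a - f b\<bar> + \<bar>f b - f c\<bar> + \<bar>f c - f d\<bar>" for f
    using neq unfolding E by (simp add: gvar_insert gvar_empty doubleton_eq_iff)
  have nbhd: "gball V E a 1 = {a, b}" "gball V E b 1 = {a, b, c}"
      "gball V E c 1 = {b, c, d}" "gball V E d 1 = {c, d}"
    unfolding nbhd_eqs using dist by (auto simp: V E doubleton_eq_iff)
  have ball2: "gball V E a 2 = {a, b, c}" "gball V E b 2 = V"
      "gball V E c 2 = V" "gball V E d 2 = {b, c, d}"
    unfolding ball2_eqs nbhd UN_insert UN_empty by (auto simp: V)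
  have ball3: "gball V E a 3 = V" "gball V E d 3 = V"
    unfolding ball3_eqs ball2 nbhd UN_insert UN_empty by (auto simp: V)
  have M: "maxop V E f a = max (f a) (max ((f a + f b) / 2) (max ((f a + f b + f c) / 3) (mean f)))"
      "maxop V E f b = max (f b) (max ((f a + f b + f c) / 3) (mean f))"
      "maxop V E f c = max (f c) (max ((f b + f c + f d) / 3) (mean f))"
      "maxop V E f d = max (f d) (max ((f c + f d) / 2) (max ((f b + f c + f d) / 3) (mean f)))"
    if "\<And>v. 0 \<le> f v" for f
    using neq mem that nbhd ball2 ball3
    by (simp_all add: maxop_eqs ball_avg_V ball_avg_2 ball_avg_3)
  show "gvar E (maxop V E f) \<le> 3/4 * gvar E f" if "\<And>v. 0 \<le> f v" for f
    using variation_le_P4[OF refl M[of f, OF that]] by (simp add: var)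
  \<comment> \<open>The values 1, 1/3, 1/4, 1/4 decrease along the path, so the variation telescopes
    to 1 - 1/4.\<close>
  show "0 < gvar E (\<lambda>v. if v = a then 1 else 0)"
    using neq by (simp add: var)
  show "3/4 * gvar E (\<lambda>v. if v = a then 1 else 0) \<le> gvar E (maxop V E (\<lambda>v. if v = a then 1 else 0))"
    using neq by (simp add: var M)
qed simp

section \<open>Identifying the graph from its edges\<close>

lemma edge_cases:
  assumes "e \<in> E"
  shows "e \<in> {{a, b}, {a, c}, {a, d}, {b, c}, {b, d}, {c, d}}"
proof -
  obtain v w where "e = {v, w}" "v \<in> V" "w \<in> V" "v \<noteq> w"
    using graph(1) assms unfolding simple_graph_def by blast
  then show ?thesis
    unfolding V by (auto simp: insert_commute)
qed

lemma edges_eqI: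
  assumes "F \<subseteq> E" and "\<And>e. e \<in> {{a, b}, {a, c}, {a, d}, {b, c}, {b, d}, {c, d}} - F \<Longrightarrow> e \<notin> E"
  shows "E = F"
proof (rule equalityI[OF subsetI assms(1)])
  fix e assume "e \<in> E"
  with assms(2)[of e] edge_cases[of e] show "e \<in> F"
    by (metis DiffI)
qed

text \<open>Transfers the result for a standard labelling to any permutation of the labels.\<close>

lemma relabel:
  assumes "{x, y, z, t} = {a, b, c, d}" and "distinct [x, y, z, t]"
  shows "four_vertices V E x y z t"
  using assms graph V by unfold_locales auto

text \<open>Only the edges among \<open>b\<close>, \<open>c\<close>, \<open>d\<close> are open:
  three give the complete graph, two the diamond, one the paw, none the star.\<close>

lemma CG_dominating_vertex:
  assumes a: "{a, b} \<in> E" "{a, c} \<in> E" "{a, d} \<in> E"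
  shows "CG V E = ereal (3/4)"
proof -
  \<comment> \<open>The last two labels are the missing edge of the diamond and the edge opposite
    \<open>a\<close> in the paw; these reorderings put \<open>b\<close>, \<open>d\<close> or
    \<open>b\<close>, \<open>c\<close> there.\<close>
  interpret acbd: four_vertices V E a c b d
    using dist by (intro relabel) auto
  interpret adbc: four_vertices V E a d b c
    using dist by (intro relabel) auto
  show ?thesis
  proof (cases "{b, c} \<in> E"; cases "{b, d} \<in> E"; cases "{c, d} \<in> E")
    assume "{b, c} \<in> E" "{b, d} \<in> E" "{c, d} \<in> E"
    with a have "E = {{a, b}, {a, c}, {a, d}, {b, c}, {b, d}, {c, d}}"
      by (intro edges_eqI) auto
    then show ?thesis
      by (rule CG_K4)
  next
    assume "{b, c} \<in> E" "{b, d} \<in> E" "{c, d} \<notin> E"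
    with a have "E = {{a, b}, {a, c}, {a, d}, {b, c}, {b, d}}"
      by (intro edges_eqI) auto
    then show ?thesis
      by (rule CG_diamond)
  next
    assume "{b, c} \<in> E" "{b, d} \<notin> E" "{c, d} \<in> E"
    with a have "E = {{a, b}, {a, c}, {a, d}, {b, c}, {c, d}}"
      by (intro edges_eqI) auto
    then show ?thesis
      by (intro acbd.CG_diamond) (simp add: insert_commute)
  next
    assume "{b, c} \<in> E" "{b, d} \<notin> E" "{c, d} \<notin> E"
    with a have "E = {{a, b}, {a, c}, {a, d}, {b, c}}"
      by (intro edges_eqI) auto
    then show ?thesis
      by (intro adbc.CG_paw) (simp add: insert_commute)
  next
    assume "{b, c} \<notin> E" "{b, d} \<in> E" "{c, d} \<in> E"
    with a have "E = {{a, b}, {a, c}, {a, d}, {b, d}, {c, d}}"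
      by (intro edges_eqI) auto
    then show ?thesis
      by (intro adbc.CG_diamond) (simp add: insert_commute)
  next
    assume "{b, c} \<notin> E" "{b, d} \<in> E" "{c, d} \<notin> E"
    with a have "E = {{a, b}, {a, c}, {a, d}, {b, d}}"
      by (intro edges_eqI) auto
    then show ?thesis
      by (intro acbd.CG_paw) (simp add: insert_commute)
  next
    assume "{b, c} \<notin> E" "{b, d} \<notin> E" "{c, d} \<in> E"
    with a have "E = {{a, b}, {a, c}, {a, d}, {c, d}}"
      by (intro edges_eqI) auto
    then show ?thesis
      by (rule CG_paw)
  next
    assume "{b, c} \<notin> E" "{b, d} \<notin> E" "{c, d} \<notin> E"
    with a have "E = {{a, b}, {a, c}, {a, d}}"
      by (intro edges_eqI) auto
    then show ?thesis
      by (rule CG_star)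
  qed
qed

text \<open>Only \<open>{c, d}\<close> is undecided: with it the graph is the cycle
  \<open>a\<close>, \<open>b\<close>, \<open>d\<close>, \<open>c\<close>, without it the path
  \<open>c\<close>, \<open>a\<close>, \<open>b\<close>, \<open>d\<close>.\<close>

lemma CG_no_dominating_vertex:
  assumes "{a, b} \<in> E" "{a, c} \<in> E" "{a, d} \<notin> E" "{b, c} \<notin> E" "{b, d} \<in> E"
  shows "CG V E = ereal (3/4)"
proof (cases "{c, d} \<in> E")
  case True
  interpret abdc: four_vertices V E a b d c
    using dist by (intro relabel) auto
  have "E = {{a, b}, {b, d}, {d, c}, {a, c}}"
    using assms True by (intro edges_eqI) (auto simp: insert_commute)
  then show ?thesis
    by (rule abdc.CG_C4)
next
  case False
  interpret cabd: four_vertices V E c a b d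
    using dist by (intro relabel) auto
  have "E = {{c, a}, {a, b}, {b, d}}"
    using assms False by (intro edges_eqI) (auto simp: insert_commute)
  then show ?thesis
    by (rule cabd.CG_P4)
qed

end

section \<open>Choosing labels in an arbitrary graph\<close>

lemma four_vertices_complete:
  assumes "simple_graph V E" "connected_graph V E" "card V = 4"
    and "{p, q, r} \<subseteq> V" "distinct [p, q, r]"
  obtains s where "four_vertices V E p q r s"
proof -
  have "card (V - {p, q, r}) = 1"
    using assms(3-5) by (subst card_Diff_subset) auto
  then obtain s where "V - {p, q, r} = {s}"
    by (auto simp: card_1_singleton_iff)
  then have "V = {p, q, r, s}" "s \<notin> {p, q, r}"
    using assms(4) by auto
  then have "four_vertices V E p q r s"
    using assms by unfold_locales auto
  then show ?thesis
    by (rule that)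
qed

text \<open>Cutting off one vertex yields an edge, and cutting off that edge yields a second edge
  attached to it.\<close>

lemma exists_path_of_length_2:
  assumes graph: "simple_graph V E" "connected_graph V E" and card: "3 \<le> card V"
  obtains p q r where "{p, q, r} \<subseteq> V" "distinct [p, q, r]" "{p, q} \<in> E" "{p, r} \<in> E"
proof -
  obtain x where x: "x \<in> V"
    using card by fastforce
  have "{x} \<noteq> V"
    using card by auto
  then obtain y where y: "y \<in> V" "y \<noteq> x" "{x, y} \<in> E"
    using connected_graph_cut[OF graph, of "{x}"] x by auto
  have "card {x, y} \<le> 2"
    by (simp add: card_insert_if)
  then have "{x, y} \<noteq> V"
    using card by auto
  then obtain u w where "u \<in> {x, y}" "w \<in> V - {x, y}" "{u, w} \<in> E"
    using connected_graph_cut[OF graph, of "{x, y}"] x y by auto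
  \<comment> \<open>The middle vertex is whichever end of the first edge carries the second.\<close>
  then show ?thesis
    using that[of x y w] that[of y x w] x y by (auto simp: insert_commute)
qed

theorem theorem2:
  fixes V :: "'a set" and E :: "'a set set"
  assumes "simple_graph V E" and "connected_graph V E" and "card V = 4"
  shows "CG V E = ereal (3/4)"
proof (cases "\<exists>a\<in>V. \<forall>w\<in>V - {a}. {a, w} \<in> E")
  \<comment> \<open>A vertex adjacent to all others leaves the complete graph, star, paw and
    diamond; the other case leaves the cycle and the path.\<close>
  case True
  then obtain a where a: "a \<in> V" "\<forall>w\<in>V - {a}. {a, w} \<in> E"
    by blast
  have "card (V - {a}) = 3"
    using assms(3) a(1) by simp
  then obtain b c d where bcd: "V - {a} = {b, c, d}" "distinct [b, c, d]"
    by (auto simp: card_3_iff)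
  then interpret four_vertices V E a b c d
    using assms a(1) by unfold_locales auto
  show ?thesis
    using a(2) bcd by (intro CG_dominating_vertex) auto
next
  case no_dominating: False
  obtain p q r where pqr: "{p, q, r} \<subseteq> V" "distinct [p, q, r]" "{p, q} \<in> E" "{p, r} \<in> E"
    using exists_path_of_length_2[OF assms(1,2)] assms(3) by auto
  obtain s where s: "four_vertices V E p q r s"
    using four_vertices_complete[OF assms pqr(1,2)] by blast
  then interpret pqrs: four_vertices V E p q r s .
  interpret prqs: four_vertices V E p r q s
    using pqrs.dist by (intro pqrs.relabel) auto
  \<comment> \<open>Otherwise \<open>p\<close> would be adjacent to all other vertices.\<close>
  have ps: "{p, s} \<notin> E"
    using no_dominating pqr(3,4) pqrs.V by auto
  have "{s} \<noteq> V"
    using assms(3) by auto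
  \<comment> \<open>The fourth vertex has some neighbour, which must be \<open>q\<close> or
    \<open>r\<close>; the two cases differ by exchanging these labels.\<close>
  then obtain w where "w \<in> V" "w \<noteq> s" "{s, w} \<in> E"
    using connected_graph_cut[OF assms(1,2), of "{s}"] pqrs.mem by auto
  then consider "{q, s} \<in> E" | "{r, s} \<in> E"
    using ps pqrs.V by (auto simp: insert_commute)
  then show ?thesis
  proof cases
    case 1
    \<comment> \<open>With this edge \<open>q\<close> would be adjacent to \<open>p\<close>,
      \<open>r\<close> and \<open>s\<close>.\<close>
    moreover from this have "{q, r} \<notin> E"
      using no_dominating pqr(3) pqrs.V by (auto simp: insert_commute)
    ultimately show ?thesis
      using pqr ps by (intro pqrs.CG_no_dominating_vertex)
  next
    case 2
    moreover from this have "{r, q} \<notin> E"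
      using no_dominating pqr(4) pqrs.V by (auto simp: insert_commute)
    ultimately show ?thesis
      using pqr ps by (intro prqs.CG_no_dominating_vertex)
  qed
qed

end
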